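(* Let $(X,T)$ be a weakly mixing system and $x\in X$. Then the subset $\omega_{\mathcal{N}_T}(x)$ is $T$-invariant.
   Context: A dynamical system $(X,T)$ consists of a nonempty compact metric space $X$ and a continuous surjective map $T:X\to X$; by standing assumption $X$ has no isolated points and is not a singleton. $\mathbb{Z}_+$ is the set of nonnegative integers. "Opene" means open and nonempty. For opene $U,V\subset X$ put $N_T(U,V)=\{n\in\mathbb{Z}_+: U\cap T^{-n}V\neq\varnothing\}$, and for $x\in X$, $G\subset X$ put $N_T(x,G)=\{n\in\mathbb{Z}_+: T^nx\in G\}$. $\mathcal{N}_T$ is the set of all subsets of $\mathbb{Z}_+$ containing some $N_T(U,V)$ with $U,V$ opene. For $x\in X$, $\omega_{\mathcal{N}_T}(x)=\bigcap_{F\in\mathcal{N}_T}\overline{\{T^ix:i\in F\}}$, i.e. the set of $z\in X$ such that $N_T(x,G)\cap N_T(U,V)\neq\varnothing$ for every neighborhood $G$ of $z$ and all opene $U,V\subset X$. A system is transitive if $N_T(U,V)\neq\varnothing$ for all opene $U,V$; $(X,T)$ is weakly mixing if $(X\times X,T\times T)$ is transitive. A set $A\subset X$ is $T$-invariant if $TA=A$. *)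

theory Defs
  imports "HOL-Analysis.Analysis"
begin

text \<open>
  The phase space is a carrier set \<open>X\<close> in a metric space type, and the map \<open>T\<close> is a total
  function of which only the values on \<open>X\<close> matter. Topological notions are relative to
  \<open>X\<close>, via \<open>top_of_set X\<close>.
\<close>

text \<open>The condition of not being a singleton follows from perfectness; it is kept because it is
  part of the usual list of standing assumptions.\<close>

definition dynamical_system :: "'a::metric_space set \<Rightarrow> ('a \<Rightarrow> 'a) \<Rightarrow> bool" where
  "dynamical_system X T \<longleftrightarrow>
     X \<noteq> {} \<and> compact X \<and> continuous_on X T \<and> T ` X = X \<and>
     (\<forall>x\<in>X. x islimpt X) \<and> \<not> is_singleton X"

definition opene :: "'a::topological_space set \<Rightarrow> 'a set \<Rightarrow> bool" where
  "opene X U \<longleftrightarrow> openin (top_of_set X) U \<and> U \<noteq> {}"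

text \<open>Here \<open>U\<close> is a subset of the phase space, so it does not matter that the preimage of
  \<open>V\<close> is taken in the whole type.\<close>

definition hitting_times :: "('a \<Rightarrow> 'a) \<Rightarrow> 'a set \<Rightarrow> 'a set \<Rightarrow> nat set" where
  "hitting_times T U V = {n. U \<inter> (T ^^ n) -` V \<noteq> {}}"

definition hitting_family :: "'a::topological_space set \<Rightarrow> ('a \<Rightarrow> 'a) \<Rightarrow> nat set set" where
  "hitting_family X T = {F. \<exists>U V. opene X U \<and> opene X V \<and> hitting_times T U V \<subseteq> F}"

definition omega_hitting :: "'a::topological_space set \<Rightarrow> ('a \<Rightarrow> 'a) \<Rightarrow> 'a \<Rightarrow> 'a set" where
  "omega_hitting X T x =
     (\<Inter>F\<in>hitting_family X T. top_of_set X closure_of ((\<lambda>i. (T ^^ i) x) ` F))"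

definition top_transitive :: "'a::topological_space set \<Rightarrow> ('a \<Rightarrow> 'a) \<Rightarrow> bool" where
  "top_transitive X T \<longleftrightarrow>
     (\<forall>U V. opene X U \<and> opene X V \<longrightarrow> hitting_times T U V \<noteq> {})"

definition weakly_mixing :: "'a::topological_space set \<Rightarrow> ('a \<Rightarrow> 'a) \<Rightarrow> bool" where
  "weakly_mixing X T \<longleftrightarrow> top_transitive (X \<times> X) (map_prod T T)"

definition invariant_subset :: "'a set \<Rightarrow> ('a \<Rightarrow> 'a) \<Rightarrow> 'a set \<Rightarrow> bool" where
  "invariant_subset X T A \<longleftrightarrow> A \<subseteq> X \<and> T ` A = A"

end

theory Submission
  imports Defs
begin

text \<open>
  Write \<open>O(F)\<close> for the closure of the partial orbit \<open>{T\<^sup>i x. i \<in> F}\<close>, so that the limit set is the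
  intersection of all \<open>O(F)\<close> with \<open>F\<close> in the hitting family. Applying \<open>T\<close> to a partial orbit
  shifts its index set by one, and the hitting family is stable under the shift in both
  directions (lemmas \<open>hitting_family_vimage_Suc\<close> and \<open>hitting_family_image_Suc\<close>).

  The shift to the left gives that \<open>T\<close> maps the limit set into itself, by continuity: \<open>T\<close> maps
  \<open>O(F - 1)\<close> into \<open>O(F)\<close>. The shift to the right gives, for a point \<open>z\<close> of the limit set and each \<open>F\<close>,
  a preimage of \<open>z\<close> in \<open>O(F)\<close>, since \<open>O(F + 1)\<close> lies in the compact set \<open>T(O(F))\<close>. To choose
  one preimage that works for all \<open>F\<close> at once, compactness reduces the question to finitely many
  \<open>F\<close>. Furstenberg's intersection lemma says that weak mixing makes the hitting family closed under
  finite intersections, so that finitely many \<open>F\<close> reduce to a single one. The same lemma lies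
  behind the shift to the right.
\<close>

lemma hitting_family_mono: "F \<in> hitting_family X T \<Longrightarrow> F \<subseteq> G \<Longrightarrow> G \<in> hitting_family X T"
  unfolding hitting_family_def by blast

lemma hitting_times_in_family:
  "opene X U \<Longrightarrow> opene X V \<Longrightarrow> hitting_times T U V \<in> hitting_family X T"
  unfolding hitting_family_def by blast

lemma opene_subset: "opene X U \<Longrightarrow> U \<subseteq> X"
  unfolding opene_def by (auto dest: openin_imp_subset)

lemma funpow_image_subset: "T ` X \<subseteq> X \<Longrightarrow> (T ^^ n) ` X \<subseteq> X"
  by (induction n) auto

lemma funpow_continuous_on:
  fixes T :: "'a::topological_space \<Rightarrow> 'a"
  assumes "continuous_on X T" "T ` X \<subseteq> X"
  shows "continuous_on X (T ^^ n)"
proof (induction n)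
  case (Suc n)
  have "continuous_on ((T ^^ n) ` X) T"
    using assms(1) funpow_image_subset[OF assms(2)] by (rule continuous_on_subset)
  then have "continuous_on X (T \<circ> T ^^ n)"
    using Suc by (intro continuous_on_compose)
  then show ?case by simp
qed (simp add: id_def)

lemma openin_vimage_funpow:
  fixes T :: "'a::topological_space \<Rightarrow> 'a"
  assumes "continuous_on X T" "T ` X \<subseteq> X" "openin (top_of_set X) V"
  shows "openin (top_of_set X) (X \<inter> (T ^^ n) -` V)"
  using funpow_image_subset[OF assms(2)]
    continuous_openin_preimage[OF funpow_continuous_on[OF assms(1,2)] _ assms(3)]
  by (auto simp: image_subset_iff)

lemma opene_vimage:
  assumes "continuous_on X T" "T ` X = X" "opene X V"
  shows "opene X (X \<inter> T -` V)"
proof -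
  obtain v where "v \<in> V" using assms(3) unfolding opene_def by blast
  moreover from this have "v \<in> T ` X" using opene_subset[OF assms(3)] assms(2) by auto
  ultimately have "X \<inter> T -` V \<noteq> {}" by auto
  then show ?thesis
    using openin_vimage_funpow[of X T V 1] assms unfolding opene_def by auto
qed

lemma hitting_family_vimage_Suc:
  assumes "continuous_on X T" "T ` X = X" "F \<in> hitting_family X T"
  shows "Suc -` F \<in> hitting_family X T"
proof -
  obtain U V where UV: "opene X U" "opene X V" "hitting_times T U V \<subseteq> F"
    using assms(3) unfolding hitting_family_def by blast
  have "hitting_times T U (X \<inter> T -` V) \<subseteq> Suc -` hitting_times T U V"
    unfolding hitting_times_def by auto
  with UV show ?thesis
    using hitting_times_in_family[OF UV(1) opene_vimage[OF assms(1,2) UV(2)]]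
    by (meson hitting_family_mono order_trans vimage_mono)
qed

text \<open>
  Furstenberg's intersection lemma. If \<open>n\<close> is a common hitting time of the pairs
  \<open>(U1, U2)\<close> and \<open>(V1, V2)\<close>, then an orbit segment from \<open>U1 \<inter> T\<^sup>-\<^sup>n U2\<close> to \<open>V1 \<inter> T\<^sup>-\<^sup>n V2\<close> leads
  from \<open>U1\<close> to \<open>V1\<close>, and its translate by \<open>n\<close> leads from \<open>U2\<close> to \<open>V2\<close> in the same time.
\<close>

lemma hitting_family_Int:
  assumes cont: "continuous_on X T" and inv: "T ` X \<subseteq> X" and wm: "weakly_mixing X T"
    and "F \<in> hitting_family X T" "G \<in> hitting_family X T"
  shows "F \<inter> G \<in> hitting_family X T"
proof -
  obtain U1 V1 where 1: "opene X U1" "opene X V1" "hitting_times T U1 V1 \<subseteq> F"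
    using assms(4) unfolding hitting_family_def by blast
  obtain U2 V2 where 2: "opene X U2" "opene X V2" "hitting_times T U2 V2 \<subseteq> G"
    using assms(5) unfolding hitting_family_def by blast
  have "opene (X \<times> X) (U1 \<times> V1)" "opene (X \<times> X) (U2 \<times> V2)"
    using 1 2 unfolding opene_def by (auto intro: openin_Times)
  then obtain n where n: "n \<in> hitting_times (map_prod T T) (U1 \<times> V1) (U2 \<times> V2)"
    using wm unfolding weakly_mixing_def top_transitive_def by blast
  have pow: "(map_prod T T ^^ n) (a, b) = ((T ^^ n) a, (T ^^ n) b)" for a b
    by (induction n) auto
  define U V where "U = U1 \<inter> (X \<inter> (T ^^ n) -` U2)" and "V = V1 \<inter> (X \<inter> (T ^^ n) -` V2)"
  have "U \<noteq> {}" "V \<noteq> {}"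
    using n opene_subset[OF 1(1)] opene_subset[OF 1(2)]
    unfolding U_def V_def hitting_times_def by (auto simp: pow)
  moreover have "openin (top_of_set X) U" "openin (top_of_set X) V"
    using 1 2 unfolding U_def V_def opene_def
    by (auto intro!: openin_Int openin_vimage_funpow[OF cont inv])
  ultimately have "opene X U" "opene X V"
    unfolding opene_def by auto
  moreover have "hitting_times T U V \<subseteq> F \<inter> G"
  proof
    fix k assume "k \<in> hitting_times T U V"
    then obtain u where u: "u \<in> U" "(T ^^ k) u \<in> V"
      unfolding hitting_times_def by auto
    have "(T ^^ k) ((T ^^ n) u) = (T ^^ n) ((T ^^ k) u)"
      by (metis add.commute comp_apply funpow_add)
    then have "k \<in> hitting_times T U1 V1" "k \<in> hitting_times T U2 V2"
      using u unfolding U_def V_def hitting_times_def by fastforce+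
    then show "k \<in> F \<inter> G" using 1(3) 2(3) by auto
  qed
  ultimately show ?thesis
    unfolding hitting_family_def by blast
qed

lemma hitting_family_Inter:
  assumes "continuous_on X T" "T ` X \<subseteq> X" "weakly_mixing X T" "X \<noteq> {}"
    and "finite \<F>" "\<F> \<subseteq> hitting_family X T"
  shows "\<Inter>\<F> \<in> hitting_family X T"
  using assms(5,6)
proof (induction \<F> rule: finite_induct)
  case empty
  have "opene X X" using assms(4) unfolding opene_def by simp
  then show ?case unfolding hitting_family_def by auto
next
  case (insert F \<F>)
  then show ?case using hitting_family_Int[OF assms(1-3)] by simp
qed

text \<open>
  A positive hitting time of \<open>T\<^sup>-\<^sup>1 U\<close> and \<open>V\<close> is the successor of a hitting time of \<open>U\<close> and \<open>V\<close>.
  The time \<open>0\<close>, which is not a successor, has to be removed; it is avoided by the hitting times of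
  two disjoint sets, and by weak mixing the intersection with these stays in the family.
\<close>

lemma hitting_family_image_Suc:
  fixes T :: "'a::t2_space \<Rightarrow> 'a"
  assumes cont: "continuous_on X T" and surj: "T ` X = X" and wm: "weakly_mixing X T"
    and ab: "a \<in> X" "b \<in> X" "a \<noteq> b" and F: "F \<in> hitting_family X T"
  shows "Suc ` F \<in> hitting_family X T"
proof -
  obtain U V where UV: "opene X U" "opene X V" "hitting_times T U V \<subseteq> F"
    using F unfolding hitting_family_def by blast
  obtain A B where AB: "open A" "open B" "a \<in> A" "b \<in> B" "A \<inter> B = {}"
    using hausdorff[OF ab(3)] by blast
  have "opene X (X \<inter> A)" "opene X (X \<inter> B)"
    using AB ab unfolding opene_def by auto
  then have "hitting_times T (X \<inter> T -` U) V \<inter> hitting_times T (X \<inter> A) (X \<inter> B)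
      \<in> hitting_family X T"
    using hitting_times_in_family opene_vimage[OF cont surj UV(1)] UV(2) surj
    by (intro hitting_family_Int[OF cont _ wm]) auto
  moreover have "hitting_times T (X \<inter> T -` U) V \<inter> hitting_times T (X \<inter> A) (X \<inter> B) \<subseteq> Suc ` F"
  proof
    fix n assume n: "n \<in> hitting_times T (X \<inter> T -` U) V \<inter> hitting_times T (X \<inter> A) (X \<inter> B)"
    then have "n \<noteq> 0"
      using AB(5) unfolding hitting_times_def by (cases n) auto
    then obtain m where m: "n = Suc m" by (cases n) auto
    then have "m \<in> hitting_times T U V"
      using n unfolding hitting_times_def by (auto simp: funpow_swap1)
    then show "n \<in> Suc ` F" using UV(3) m by auto
  qed
  ultimately show ?thesis by (rule hitting_family_mono)
qed

lemma image_orbit_segment: "T ` (\<lambda>i. (T ^^ i) x) ` F = (\<lambda>i. (T ^^ i) x) ` Suc ` F"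
  by (simp add: image_image)

theorem proposition3p5:
  fixes X :: "'a::metric_space set" and T :: "'a \<Rightarrow> 'a" and x :: 'a
  assumes "dynamical_system X T"
    and "weakly_mixing X T"
    and "x \<in> X"
  shows "invariant_subset X T (omega_hitting X T x)"
proof -
  have ne: "X \<noteq> {}" and comp: "compact X" and cont: "continuous_on X T" and surj: "T ` X = X"
    and ns: "\<not> is_singleton X"
    using assms(1) unfolding dynamical_system_def by auto
  obtain a b where ab: "a \<in> X" "b \<in> X" "a \<noteq> b"
    using ns ne by (metis is_singletonI')
  define orb where "orb F = (\<lambda>i. (T ^^ i) x) ` F" for F :: "nat set"
  have "(T ^^ i) x \<in> X" for i
    using funpow_image_subset[of T X i] assms(3) surj by blast
  then have orb_X: "orb F \<subseteq> X" for F
    unfolding orb_def by auto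
  then have cl_X: "closure (orb F) \<subseteq> X" for F
    using comp by (intro closure_minimal compact_imp_closed)
  have orb_Suc: "T ` orb F = orb (Suc ` F)" for F
    unfolding orb_def by (rule image_orbit_segment)
  have cont_cl: "continuous_on (closure (orb F)) T" for F
    using cont cl_X by (rule continuous_on_subset)
  have omega: "omega_hitting X T x = (\<Inter>F\<in>hitting_family X T. closure (orb F))"
    unfolding omega_hitting_def orb_def[symmetric] closure_of_subtopology
    using orb_X cl_X by (simp add: Int_absorb1)
  have UNIV_family: "UNIV \<in> hitting_family X T"
    using hitting_family_Inter[OF cont _ assms(2) ne, of "{}"] surj by simp
  have "T z \<in> omega_hitting X T x" if z: "z \<in> omega_hitting X T x" for z
    unfolding omega
  proof
    fix F assume "F \<in> hitting_family X T"
    then have "z \<in> closure (orb (Suc -` F))"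
      using z hitting_family_vimage_Suc[OF cont surj] unfolding omega by blast
    moreover have "T ` orb (Suc -` F) \<subseteq> closure (orb F)"
      unfolding orb_Suc using closure_subset[of "orb F"] unfolding orb_def by blast
    ultimately show "T z \<in> closure (orb F)"
      using image_closure_subset[OF cont_cl closed_closure] by blast
  qed
  moreover have "z \<in> T ` omega_hitting X T x" if z: "z \<in> omega_hitting X T x" for z
  proof -
    have preimage: "\<exists>y\<in>closure (orb F). T y = z" if F: "F \<in> hitting_family X T" for F
    proof -
      have "compact (closure (orb F))"
        using cl_X compact_Int_closed[OF comp closed_closure, of "orb F"]
        by (simp add: Int_absorb1)
      then have "closed (T ` closure (orb F))"
        by (intro compact_imp_closed compact_continuous_image cont_cl)
      moreover have "orb (Suc ` F) \<subseteq> T ` closure (orb F)"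
        unfolding orb_Suc[symmetric] by (intro image_mono closure_subset)
      ultimately have "closure (orb (Suc ` F)) \<subseteq> T ` closure (orb F)"
        by (intro closure_minimal)
      then show ?thesis
        using z hitting_family_image_Suc[OF cont surj assms(2) ab F] unfolding omega by blast
    qed
    \<comment> \<open>The preimages of \<open>z\<close> in the various closures are the traces of these closures on the
      compact fibre \<open>K\<close>; they have the finite intersection property.\<close>
    define K where "K = X \<inter> T -` {z}"
    have "closed K"
      unfolding K_def using comp cont
      by (intro continuous_closed_preimage compact_imp_closed closed_singleton)
    then have "compact K"
      using compact_Int_closed[OF comp, of K] unfolding K_def by (simp add: Int_absorb1)
    then have "K \<inter> (\<Inter>F\<in>hitting_family X T. closure (orb F)) \<noteq> {}"
    proof (rule compact_imp_fip_image)
      fix \<F> assume \<F>: "finite \<F>" "\<F> \<subseteq> hitting_family X T"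
      have "\<Inter>\<F> \<in> hitting_family X T"
        using hitting_family_Inter[OF cont _ assms(2) ne \<F>] surj by simp
      then obtain y where y: "y \<in> closure (orb (\<Inter>\<F>))" "T y = z"
        using preimage by blast
      have "closure (orb (\<Inter>\<F>)) \<subseteq> closure (orb F)" if "F \<in> \<F>" for F
        using that unfolding orb_def by (intro closure_mono image_mono) blast
      then have "y \<in> K \<inter> (\<Inter>F\<in>\<F>. closure (orb F))"
        using y cl_X unfolding K_def by blast
      then show "K \<inter> (\<Inter>F\<in>\<F>. closure (orb F)) \<noteq> {}" by blast
    qed (rule closed_closure)
    then obtain y where "y \<in> K" "y \<in> omega_hitting X T x"
      unfolding omega by auto
    then show ?thesis
      unfolding K_def by auto
  qed
  moreover have "omega_hitting X T x \<subseteq> X"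
    unfolding omega using UNIV_family cl_X by blast
  ultimately show ?thesis
    unfolding invariant_subset_def by (intro conjI equalityI subsetI) auto
qed

end
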